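(* Let $f_1:[a,b]\to\mathbb{R}$ ($a<b$) be a polynomial of degree $m\ge 1$ such that $f_1'>0$ on $(a,b)$, let $B_n^{f_1}$ be the generalized Bernstein operator over $[a,b]$ fixing $f_1$ and the constant function $\mathbf{1}$ (which exists for all sufficiently large $n$), and let $B_n$ be the classical Bernstein operator over $[a,b]$. Then there exist a constant $K>0$ and a natural number $n_0$ such that for all $f\in C[a,b]$, all $x\in[a,b]$ and all $n\ge n_0$, $$\left|B_n^{f_1}f(x)-B_nf(x)\right|\le\omega\left(f,Kn^{-1}\right).$$
   Context: $\mathbb{P}_n[a,b]$ is the space of real polynomials of degree at most $n$ on $[a,b]$, with the standard Bernstein basis $p_{n,k}(x)=\binom{n}{k}\frac{(x-a)^k(b-x)^{n-k}}{(b-a)^n}$, $k=0,\dots,n$. The classical Bernstein operator is $B_nf=\sum_{k=0}^n f\left(a+\frac{k}{n}(b-a)\right)p_{n,k}$. A generalized Bernstein operator $C[a,b]\to\mathbb{P}_n[a,b]$ is an operator of the form $f\mapsto\sum_{k=0}^n f(t_{n,k})\,\alpha_{n,k}\,p_{n,k}$ with nodes $t_{n,k}\in[a,b]$ and weights $\alpha_{n,k}>0$. For $f_1\in\mathbb{P}_n[a,b]$ strictly increasing on $[a,b]$, $f_1=\sum_{k=0}^n\gamma_{n,k}p_{n,k}$, the operator $B_n^{f_1}$ is the unique (if it exists) generalized Bernstein operator fixing (i.e. mapping to themselves) $\mathbf{1}$ and $f_1$; it has weights $\alpha_{n,k}=1$ and nodes $t_{n,k}=f_1^{-1}(\gamma_{n,k})$,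 and it exists exactly when all $\gamma_{n,k}\in[f_1(a),f_1(b)]$. The modulus of continuity of $f\in C[a,b]$ is $\omega(f,\delta)=\sup\{|f(x)-f(y)|:x,y\in[a,b],\ |x-y|\le\delta\}$. *)

theory Defs
  imports "HOL-Analysis.Analysis" "HOL-Computational_Algebra.Polynomial"
begin

text \<open>
  A function on \<open>[a,b]\<close> is represented by a total function \<open>real \<Rightarrow> real\<close> of which only the
  values on \<open>{a..b}\<close> matter.
\<close>

definition bernstein_basis :: "real \<Rightarrow> real \<Rightarrow> nat \<Rightarrow> nat \<Rightarrow> real \<Rightarrow> real" where
  "bernstein_basis a b n k x =
     real (n choose k) * ((x - a) ^ k * (b - x) ^ (n - k)) / (b - a) ^ n"

lemma bernstein_basis_eq_Bernstein:
  assumes "a < b" "k \<le> n"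
  shows "bernstein_basis a b n k x = Bernstein n k ((x - a) / (b - a))"
proof -
  have "1 - (x - a) / (b - a) = (b - x) / (b - a)"
    using assms by (simp add: field_simps)
  moreover have "(b - a) ^ n = (b - a) ^ k * (b - a) ^ (n - k)"
    using assms by (simp flip: power_add)
  ultimately show ?thesis
    by (simp add: bernstein_basis_def Bernstein_def power_divide)
qed

definition classical_bernstein :: "real \<Rightarrow> real \<Rightarrow> nat \<Rightarrow> (real \<Rightarrow> real) \<Rightarrow> real \<Rightarrow> real" where
  "classical_bernstein a b n f x =
     (\<Sum>k\<le>n. f (a + real k / real n * (b - a)) * bernstein_basis a b n k x)"

text \<open>
  The defining formula is required for all total \<open>f\<close> and \<open>x\<close>. As the nodes lie in \<open>[a,b]\<close> and
  the result is a polynomial in \<open>x\<close>, such an operator is determined by its action from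
  \<open>C[a,b]\<close> to functions on \<open>[a,b]\<close>, so that equality and uniqueness of operators have their
  usual meaning.
\<close>

definition generalized_bernstein ::
    "real \<Rightarrow> real \<Rightarrow> nat \<Rightarrow> ((real \<Rightarrow> real) \<Rightarrow> real \<Rightarrow> real) \<Rightarrow> bool" where
  "generalized_bernstein a b n T \<longleftrightarrow>
     (\<exists>t \<alpha>. (\<forall>k\<le>n. t k \<in> {a..b} \<and> 0 < \<alpha> k) \<and>
            T = (\<lambda>f x. \<Sum>k\<le>n. f (t k) * \<alpha> k * bernstein_basis a b n k x))"

definition fixes_on ::
    "real \<Rightarrow> real \<Rightarrow> ((real \<Rightarrow> real) \<Rightarrow> real \<Rightarrow> real) \<Rightarrow> (real \<Rightarrow> real) \<Rightarrow> bool" where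
  "fixes_on a b T g \<longleftrightarrow> (\<forall>x\<in>{a..b}. T g x = g x)"

definition generalized_bernstein_fixing ::
    "real \<Rightarrow> real \<Rightarrow> (real \<Rightarrow> real) \<Rightarrow> nat \<Rightarrow> ((real \<Rightarrow> real) \<Rightarrow> real \<Rightarrow> real) \<Rightarrow> bool" where
  "generalized_bernstein_fixing a b f1 n T \<longleftrightarrow>
     generalized_bernstein a b n T \<and> fixes_on a b T (\<lambda>_. 1) \<and> fixes_on a b T f1"

text \<open>Meaningful only when such an operator exists and is unique.\<close>

definition bernstein_fixing ::
    "real \<Rightarrow> real \<Rightarrow> (real \<Rightarrow> real) \<Rightarrow> nat \<Rightarrow> (real \<Rightarrow> real) \<Rightarrow> real \<Rightarrow> real" where
  "bernstein_fixing a b f1 n = (THE T. generalized_bernstein_fixing a b f1 n T)"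

definition modulus_of_continuity :: "real \<Rightarrow> real \<Rightarrow> (real \<Rightarrow> real) \<Rightarrow> real \<Rightarrow> real" where
  "modulus_of_continuity a b f \<delta> =
     Sup {\<bar>f x - f y\<bar> | x y. x \<in> {a..b} \<and> y \<in> {a..b} \<and> \<bar>x - y\<bar> \<le> \<delta>}"

end

theory Submission
  imports Defs
begin

text \<open>
  After the affine substitution \<open>g u = f1 (a + u (b - a))\<close> the problem lives on \<open>[0,1]\<close>. The
  operator fixing \<open>1\<close> and \<open>f1\<close> has unit weights and its nodes are the preimages under \<open>f1\<close> of the
  Bernstein coefficients \<open>\<gamma> n k\<close> of \<open>g\<close>. Both operators are therefore averages of values of \<open>f\<close>
  against the same nonnegative weights \<open>p n k\<close>, which sum to \<open>1\<close>, and it suffices to find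
  \<open>t n k \<in> [0,1]\<close> with \<open>g (t n k) = \<gamma> n k\<close> and \<open>\<bar>t n k - k/n\<bar> \<le> K/n\<close>, with \<open>K\<close>
  independent of \<open>k \<le> n\<close> and of large \<open>n\<close>; this is \<open>node_near\<close>.

  The difficulty is that \<open>g'\<close> may vanish at the end points, where an estimate
  \<open>\<gamma> n k - g (k/n) = O(1/n)\<close> only places the node within a distance \<open>O((1/n) powr (1/P))\<close> of
  \<open>k/n\<close>, where \<open>P - 1\<close> is the order of that zero of \<open>g'\<close>. By reflection, consider \<open>u = k/n \<le> 1/2\<close> only, and write
  \<open>g u = g 0 + u ^ P H u\<close> with \<open>H 0 \<noteq> 0\<close>. Then \<open>g' u \<ge> c u ^ (P - 1)\<close> on \<open>[0, 3/4]\<close> for some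
  \<open>c > 0\<close>. On the other side, the Bernstein coefficients of \<open>u q\<close> of degree \<open>n\<close> are \<open>k/n\<close> times the
  shifted coefficients of \<open>q\<close> of degree \<open>n - 1\<close>, so that the zero of order \<open>P\<close> is inherited by the
  error: \<open>\<bar>\<gamma> n k - g u\<bar> \<le> C u ^ (P - 1) / n\<close> (\<open>bernstein_coeff_root_error\<close>). The two powers match,
  and \<open>g (u - K/n) \<le> \<gamma> n k \<le> g (u + K/n)\<close> for large \<open>K\<close>. If \<open>u < K/n\<close>, the lower bound becomes
  \<open>g 0 \<le> \<gamma> n k\<close>, which holds because \<open>\<gamma> n k - g 0\<close> is a nonnegative product times a Bernstein
  coefficient of \<open>H\<close>, close to \<open>H u > 0\<close>. The intermediate value theorem gives the node.
\<close>

section \<open>Bernstein coefficients of a polynomial\<close>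

text \<open>
  The \<open>k\<close>-th coefficient of \<open>p\<close> with respect to the Bernstein basis of degree \<open>n\<close> on \<open>[0,1]\<close>, as a
  quotient of falling factorials: \<open>u ^ j\<close> has the coefficient
  \<open>k (k - 1) \<dots> (k - j + 1) / (n (n - 1) \<dots> (n - j + 1))\<close>. It has this meaning only for natural
  \<open>k \<le> n\<close> with \<open>degree p \<le> n\<close>. With \<open>n\<close> and \<open>k\<close> real, the recursion over the coefficients of \<open>p\<close>
  holds without side conditions.
\<close>
definition bernstein_coeff :: "real poly \<Rightarrow> real \<Rightarrow> real \<Rightarrow> real" where
  "bernstein_coeff p n k =
     (\<Sum>j\<le>degree p. coeff p j * (\<Prod>i<j. (k - real i) / (n - real i)))"

lemma bernstein_coeff_0 [simp]: "bernstein_coeff 0 n k = 0"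
  by (simp add: bernstein_coeff_def)

lemma bernstein_coeff_pCons:
  "bernstein_coeff (pCons c p) n k = c + k / n * bernstein_coeff p (n - 1) (k - 1)"
proof (cases "p = 0")
  case True
  then show ?thesis by (simp add: bernstein_coeff_def)
next
  case False
  have "(\<Prod>i<Suc j. (k - real i) / (n - real i))
      = k / n * (\<Prod>i<j. (k - 1 - real i) / (n - 1 - real i))" for j
    by (simp add: prod.lessThan_Suc_shift algebra_simps del: prod.lessThan_Suc)
  then show ?thesis
    using False
    by (simp add: bernstein_coeff_def sum.atMost_Suc_shift sum_distrib_left mult_ac
        del: sum.atMost_Suc prod.lessThan_Suc)
qed

lemma bernstein_coeff_minus: "bernstein_coeff (- p) n k = - bernstein_coeff p n k"
  by (simp add: bernstein_coeff_def sum_negf)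

lemma Bernstein_Suc_Suc:
  "real (Suc k) / real (Suc n) * Bernstein (Suc n) (Suc k) u = u * Bernstein n k u"
proof -
  have "real (Suc k) * real (Suc n choose Suc k) = real (Suc n) * real (n choose k)"
    by (metis Suc_times_binomial_eq mult.commute of_nat_mult)
  then have "real (Suc k) / real (Suc n) * real (Suc n choose Suc k) = real (n choose k)"
    by (simp add: field_simps del: binomial_Suc_Suc of_nat_Suc)
  moreover have "real (Suc k) / real (Suc n) * Bernstein (Suc n) (Suc k) u
      = (real (Suc k) / real (Suc n) * real (Suc n choose Suc k)) * u ^ Suc k * (1 - u) ^ (n - k)"
    by (simp only: Bernstein_def diff_Suc_Suc mult.assoc)
  ultimately show ?thesis
    by (simp add: Bernstein_def)
qed

lemma poly_eq_bernstein_sum: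
  assumes "degree p \<le> n"
  shows "poly p u = (\<Sum>k\<le>n. bernstein_coeff p (real n) (real k) * Bernstein n k u)"
  using assms
proof (induction p arbitrary: n)
  case 0
  then show ?case by simp
next
  case (pCons c p)
  show ?case
  proof (cases "p = 0")
    case True
    then have "bernstein_coeff (pCons c p) (real n) k = c" for k
      by (simp add: bernstein_coeff_pCons)
    then have "(\<Sum>k\<le>n. bernstein_coeff (pCons c p) (real n) (real k) * Bernstein n k u)
        = c * (\<Sum>k\<le>n. Bernstein n k u)"
      by (simp only: sum_distrib_left)
    then show ?thesis by (simp only: sum_Bernstein) (simp add: True)
  next
    case False
    then obtain N where N: "n = Suc N" "degree p \<le> N"
      using pCons.prems by (cases n) auto
    have "(\<Sum>k\<le>n. bernstein_coeff (pCons c p) (real n) (real k) * Bernstein n k u)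
        = c * (\<Sum>k\<le>n. Bernstein n k u)
          + (\<Sum>k\<le>n. real k / real n * Bernstein n k u * bernstein_coeff p (real n - 1) (real k - 1))"
      by (simp only: bernstein_coeff_pCons distrib_right sum.distrib sum_distrib_left) (simp add: mult_ac)
    also have "(\<Sum>k\<le>n. real k / real n * Bernstein n k u * bernstein_coeff p (real n - 1) (real k - 1))
        = (\<Sum>k\<le>N. real (Suc k) / real (Suc N) * Bernstein (Suc N) (Suc k) u
            * bernstein_coeff p (real N) (real k))"
      unfolding N(1) by (subst sum.atMost_Suc_shift) (simp add: algebra_simps)
    also have "\<dots> = u * poly p u"
      unfolding Bernstein_Suc_Suc pCons.IH[OF N(2)]
      by (simp add: sum_distrib_left mult_ac)
    finally show ?thesis by simp
  qed
qed

text \<open>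
  The Bernstein polynomials of degree \<open>n\<close> are linearly independent. In \<open>z = u / (1 - u)\<close>, a linear
  combination of them is \<open>(1 + z) ^ (-n)\<close> times a polynomial that vanishes at all \<open>z > 0\<close>.
\<close>
lemma Bernstein_coeffs_eqI:
  assumes eq: "\<And>u. 0 < u \<Longrightarrow> u < 1 \<Longrightarrow>
      (\<Sum>k\<le>n. c k * Bernstein n k u) = (\<Sum>k\<le>n. d k * Bernstein n k u)"
    and "k \<le> n"
  shows "c k = d k"
proof -
  define e where "e = (\<lambda>k. (c k - d k) * real (n choose k))"
  define q where "q = (\<Sum>k\<le>n. monom (e k) k)"
  have "poly q z = 0" if "z > 0" for z
  proof -
    define u where "u = z / (1 + z)"
    have u: "0 < u" "u < 1" "1 - u = 1 / (1 + z)"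
      using that by (auto simp: u_def field_simps)
    have "c k * Bernstein n k u - d k * Bernstein n k u = e k * z ^ k / (1 + z) ^ n" if "k \<le> n" for k
    proof -
      have "(1 + z) ^ n = (1 + z) ^ k * (1 + z) ^ (n - k)"
        using that by (simp flip: power_add)
      then show ?thesis
        unfolding Bernstein_def u(3) by (simp add: e_def u_def power_divide left_diff_distrib right_diff_distrib diff_divide_distrib mult_ac)
    qed
    then have "(\<Sum>k\<le>n. e k * z ^ k / (1 + z) ^ n)
        = (\<Sum>k\<le>n. c k * Bernstein n k u - d k * Bernstein n k u)"
      by (intro sum.cong) auto
    also have "\<dots> = 0" using eq[OF u(1,2)] by (simp only: sum_subtractf)
    finally have "(\<Sum>k\<le>n. e k * z ^ k / (1 + z) ^ n) = 0" .
    then show ?thesis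
      using that by (simp add: q_def poly_sum poly_monom flip: sum_divide_distrib)
  qed
  then have "{0<..} \<subseteq> {z. poly q z = 0}" by auto
  then have "q = 0"
    using poly_roots_finite infinite_Ioi finite_subset by blast
  then have "coeff q k = 0" by simp
  then have "e k = 0" using \<open>k \<le> n\<close> by (simp add: q_def coeff_sum)
  then show ?thesis using \<open>k \<le> n\<close> by (simp add: e_def)
qed

lemma bernstein_coeff_reflect:
  assumes "degree p \<le> n" "k \<le> n"
  shows "bernstein_coeff (p \<circ>\<^sub>p [:1, -1:]) (real n) (real (n - k)) = bernstein_coeff p (real n) (real k)"
proof (rule Bernstein_coeffs_eqI[OF _ \<open>k \<le> n\<close>])
  fix u :: real
  have "degree (p \<circ>\<^sub>p [:1, -1:]) \<le> n" using assms by (simp add: degree_pcompose)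
  from poly_eq_bernstein_sum[OF this, of "1 - u"]
  have "poly p u = (\<Sum>k\<le>n. bernstein_coeff (p \<circ>\<^sub>p [:1, -1:]) (real n) (real k) * Bernstein n k (1 - u))"
    by (simp add: poly_pcompose)
  also have "\<dots> = (\<Sum>k\<le>n. bernstein_coeff (p \<circ>\<^sub>p [:1, -1:]) (real n) (real (n - k)) * Bernstein n k u)"
    by (rule sum.reindex_bij_witness[where i = "\<lambda>k. n - k" and j = "\<lambda>k. n - k"])
      (auto simp: Bernstein_def binomial_symmetric[symmetric])
  finally show "(\<Sum>k\<le>n. bernstein_coeff (p \<circ>\<^sub>p [:1, -1:]) (real n) (real (n - k)) * Bernstein n k u)
      = (\<Sum>k\<le>n. bernstein_coeff p (real n) (real k) * Bernstein n k u)"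
    using poly_eq_bernstein_sum[OF assms(1)] by simp
qed

section \<open>Distance of the coefficients from the values of the polynomial\<close>

lemma poly_bounded_on_unit:
  fixes p :: "real poly"
  obtains M where "M \<ge> 0" "\<And>u. 0 \<le> u \<Longrightarrow> u \<le> 1 \<Longrightarrow> \<bar>poly p u\<bar> \<le> M"
proof -
  have "compact (poly p ` {0..1})"
    by (intro compact_continuous_image continuous_intros) simp
  then obtain M where "\<forall>x\<in>poly p ` {0..1}. norm x \<le> M"
    using compact_imp_bounded bounded_iff by metis
  then show ?thesis by (intro that[of "max M 0"]) (auto simp: le_max_iff_disj)
qed

lemma shifted_ratio:
  fixes n k S :: nat
  assumes "S \<le> k" "k \<le> n"
  shows "(real k - real S) / (real n - real S) \<le> real k / real n"
    and "0 \<le> (real k - real S) / (real n - real S)"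
    and "\<bar>(real k - real S) / (real n - real S) - real k / real n\<bar> \<le> real S / real n"
proof -
  show "0 \<le> (real k - real S) / (real n - real S)" using assms by simp
  have *: "(real k - real S) / (real n - real S) \<le> real k / real n \<and>
        \<bar>(real k - real S) / (real n - real S) - real k / real n\<bar> \<le> real S / real n"
  proof (cases "n = S")
    case True
    then show ?thesis using assms by simp
  next
    case False
    then have n: "real n - real S > 0" "real n > 0" using assms by auto
    have d: "real k / real n - (real k - real S) / (real n - real S)
        = real S / real n * ((real n - real k) / (real n - real S))"
      using n by (simp add: field_simps)
    have "(real n - real k) / (real n - real S) \<le> 1" "0 \<le> (real n - real k) / (real n - real S)"
      using assms n by (auto simp: field_simps)
    then have "0 \<le> real S / real n * ((real n - real k) / (real n - real S))"
      "real S / real n * ((real n - real k) / (real n - real S)) \<le> real S / real n * 1"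
      by (intro mult_nonneg_nonneg mult_left_mono; simp)+
    then show ?thesis using d by linarith
  qed
  then show "(real k - real S) / (real n - real S) \<le> real k / real n"
    "\<bar>(real k - real S) / (real n - real S) - real k / real n\<bar> \<le> real S / real n"
    by auto
qed

text \<open>
  One step of the recursion for the error. The degree and the index are both lowered by \<open>S\<close>, but the
  coefficient is compared with the value at the unshifted point \<open>k / n\<close>, so that the recursion,
  which raises \<open>S\<close> by one, keeps this point.
\<close>
lemma bernstein_coeff_error_step:
  fixes n k S :: nat
  assumes Sk: "S \<le> k" "k \<le> n"
    and E: "Suc S \<le> k \<Longrightarrow>
      \<bar>bernstein_coeff q (real n - real (Suc S)) (real k - real (Suc S)) - poly q (real k / real n)\<bar> \<le> E"
    and "0 \<le> E" and M: "\<bar>poly q (real k / real n)\<bar> \<le> M"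
  shows "\<bar>bernstein_coeff (pCons c q) (real n - real S) (real k - real S)
       - poly (pCons c q) (real k / real n)\<bar> \<le> real k / real n * E + real S / real n * M"
proof -
  let ?v = "(real k - real S) / (real n - real S)" and ?u = "real k / real n"
  let ?L = "bernstein_coeff q (real n - real (Suc S)) (real k - real (Suc S))"
  note v = shifted_ratio[OF Sk]
  have "bernstein_coeff (pCons c q) (real n - real S) (real k - real S) - poly (pCons c q) ?u
      = ?v * (?L - poly q ?u) + (?v - ?u) * poly q ?u"
    by (simp add: bernstein_coeff_pCons algebra_simps)
  \<comment> \<open>If \<open>S = k\<close>, the hypothesis \<open>E\<close> says nothing about \<open>?L\<close>, but then \<open>?v = 0\<close>.\<close>
  moreover have "\<bar>?v * (?L - poly q ?u)\<bar> \<le> ?u * E"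
  proof (cases "S = k")
    case True
    then show ?thesis using \<open>0 \<le> E\<close> by simp
  next
    case False
    then have "\<bar>?L - poly q ?u\<bar> \<le> E" using E Sk by simp
    then have "\<bar>?v\<bar> * \<bar>?L - poly q ?u\<bar> \<le> ?u * E"
      using v by (intro mult_mono) (simp_all only: abs_of_nonneg abs_ge_zero divide_nonneg_nonneg of_nat_0_le_iff)
    then show ?thesis by (simp only: abs_mult)
  qed
  moreover have "\<bar>(?v - ?u) * poly q ?u\<bar> \<le> real S / real n * M"
    unfolding abs_mult using v M by (intro mult_mono) auto
  ultimately show ?thesis by (smt (verit) abs_triangle_ineq)
qed

lemma bernstein_coeff_shift_error:
  "\<exists>C\<ge>0. \<forall>n k. S \<le> k \<longrightarrow> k \<le> n \<longrightarrow>
     \<bar>bernstein_coeff p (real n - real S) (real k - real S) - poly p (real k / real n)\<bar> \<le> C / real n"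
proof (induction p arbitrary: S)
  case 0
  then show ?case by (intro exI[of _ 0]) simp
next
  case (pCons c p)
  obtain C where C: "C \<ge> 0" "\<And>n k. Suc S \<le> k \<Longrightarrow> k \<le> n \<Longrightarrow>
     \<bar>bernstein_coeff p (real n - real (Suc S)) (real k - real (Suc S)) - poly p (real k / real n)\<bar>
       \<le> C / real n"
    using pCons.IH[of "Suc S"] by blast
  obtain M where M: "M \<ge> 0" "\<And>u. 0 \<le> u \<Longrightarrow> u \<le> 1 \<Longrightarrow> \<bar>poly p u\<bar> \<le> M"
    using poly_bounded_on_unit by blast
  show ?case
  proof (intro exI[of _ "C + real S * M"] conjI allI impI)
    show "0 \<le> C + real S * M" using C M by simp
    fix n k assume Sk: "S \<le> k" "k \<le> n"
    have u: "0 \<le> real k / real n" "real k / real n \<le> 1" using Sk by (auto simp: divide_le_eq)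
    have "\<bar>bernstein_coeff (pCons c p) (real n - real S) (real k - real S)
       - poly (pCons c p) (real k / real n)\<bar> \<le> real k / real n * (C / real n) + real S / real n * M"
      using C Sk M(2)[OF u] by (intro bernstein_coeff_error_step) auto
    also have "real k / real n * (C / real n) \<le> 1 * (C / real n)"
      using u C by (intro mult_right_mono) auto
    finally show "\<bar>bernstein_coeff (pCons c p) (real n - real S) (real k - real S)
       - poly (pCons c p) (real k / real n)\<bar> \<le> (C + real S * M) / real n"
      by (simp add: add_divide_distrib)
  qed
qed

text \<open>
  A zero of order \<open>P \<ge> 1\<close> at the origin improves the error near the origin by the factor
  \<open>(k / n) ^ (P - 1)\<close>. For \<open>P = 0\<close> the truncated exponent is \<open>0\<close>, and the bound is the general one.
\<close>
lemma bernstein_coeff_root_error: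
  "\<exists>C\<ge>0. \<forall>n k. S \<le> k \<longrightarrow> k \<le> n \<longrightarrow>
     \<bar>bernstein_coeff ([:0, 1:] ^ P * H) (real n - real S) (real k - real S)
        - poly ([:0, 1:] ^ P * H) (real k / real n)\<bar> \<le> C * (real k / real n) ^ (P - 1) / real n"
proof (induction P arbitrary: S)
  case 0
  then show ?case using bernstein_coeff_shift_error[of S H] by simp
next
  case (Suc P)
  define q where "q = [:0, 1:] ^ P * H"
  have q: "[:0, 1:] ^ Suc P * H = pCons 0 q" by (simp add: q_def)
  obtain C where C: "C \<ge> 0" "\<And>n k. Suc S \<le> k \<Longrightarrow> k \<le> n \<Longrightarrow>
     \<bar>bernstein_coeff q (real n - real (Suc S)) (real k - real (Suc S)) - poly q (real k / real n)\<bar>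
       \<le> C * (real k / real n) ^ (P - 1) / real n"
    using Suc.IH[of "Suc S"] unfolding q_def by blast
  obtain M where M: "M \<ge> 0" "\<And>u. 0 \<le> u \<Longrightarrow> u \<le> 1 \<Longrightarrow> \<bar>poly H u\<bar> \<le> M"
    using poly_bounded_on_unit by blast
  show ?case unfolding q
  proof (intro exI[of _ "C + real S * M"] conjI allI impI)
    show "0 \<le> C + real S * M" using C M by simp
    fix n k assume Sk: "S \<le> k" "k \<le> n"
    let ?u = "real k / real n"
    have u: "0 \<le> ?u" "?u \<le> 1" using Sk by (auto simp: divide_le_eq)
    have "\<bar>poly q ?u\<bar> \<le> ?u ^ P * M"
      unfolding q_def using M(2)[OF u] u by (simp add: poly_power abs_mult mult_left_mono)
    then have "\<bar>bernstein_coeff (pCons 0 q) (real n - real S) (real k - real S) - poly (pCons 0 q) ?u\<bar>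
       \<le> ?u * (C * ?u ^ (P - 1) / real n) + real S / real n * (?u ^ P * M)"
      using C Sk by (intro bernstein_coeff_error_step) auto
    also have "?u * (C * ?u ^ (P - 1) / real n) = (?u * ?u ^ (P - 1)) * (C / real n)"
      by simp
    also have "\<dots> \<le> ?u ^ P * (C / real n)"
      using u C by (intro mult_right_mono) (cases P; auto)+
    finally show "\<bar>bernstein_coeff (pCons 0 q) (real n - real S) (real k - real S) - poly (pCons 0 q) ?u\<bar>
       \<le> (C + real S * M) * ?u ^ (Suc P - 1) / real n"
      by (simp add: distrib_right add_divide_distrib mult_ac del: power_divide)
  qed
qed

lemma bernstein_coeff_power_mult:
  "bernstein_coeff ([:0, 1:] ^ P * H) n k
     = (\<Prod>i<P. (k - real i) / (n - real i)) * bernstein_coeff H (n - real P) (k - real P)"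
proof (induction P arbitrary: n k)
  case (Suc P)
  have "[:0, 1:] ^ Suc P * H = pCons 0 ([:0, 1:] ^ P * H)" by simp
  then show ?case
    by (simp only: bernstein_coeff_pCons Suc prod.lessThan_Suc_shift)
      (simp add: diff_diff_eq add.commute)
qed simp

text \<open>If \<open>k < P\<close>, the quotient of falling factorials contains the factor \<open>k - k\<close>.\<close>
lemma bernstein_coeff_power_mult_nonneg:
  fixes n k :: nat
  assumes "k \<le> n" "P \<le> k \<Longrightarrow> 0 \<le> bernstein_coeff H (real n - real P) (real k - real P)"
  shows "0 \<le> bernstein_coeff ([:0, 1:] ^ P * H) (real n) (real k)"
proof (cases "P \<le> k")
  case True
  then have "0 \<le> (\<Prod>i<P. (real k - real i) / (real n - real i))"
    using assms(1) by (intro prod_nonneg) simp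
  then show ?thesis using assms True by (simp add: bernstein_coeff_power_mult)
next
  case False
  then have "(\<Prod>i<P. (real k - real i) / (real n - real i)) = 0"
    using False by (intro prod_zero) (auto intro!: bexI[of _ k])
  then show ?thesis by (simp only: bernstein_coeff_power_mult mult_zero_left)
qed

section \<open>Nodes near the equidistant points\<close>

lemma node_near_lower_half:
  fixes g :: "real poly"
  assumes deriv_pos: "\<And>u. 0 < u \<Longrightarrow> u < 1 \<Longrightarrow> poly (pderiv g) u > 0"
  shows "\<exists>K>0. \<exists>n0. \<forall>n\<ge>n0. \<forall>k. 2 * k \<le> n \<longrightarrow>
    (\<exists>t\<in>{0..1}. poly g t = bernstein_coeff g (real n) (real k) \<and> \<bar>t - real k / real n\<bar> \<le> K / real n)"
proof -
  obtain c q where g: "g = pCons c q" by (cases g)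
  define D where "D = pCons 0 q"
  have poly_g: "poly g u = c + poly D u" for u by (simp add: g D_def)
  have coeff_g: "bernstein_coeff g n k = c + bernstein_coeff D n k" for n k
    by (simp add: g D_def bernstein_coeff_pCons)
  have pderiv_g: "pderiv g = pderiv D" by (simp add: g D_def pderiv_pCons)
  have "D \<noteq> 0" using deriv_pos[of "1/2"] by (auto simp: pderiv_g)
  define P where "P = order 0 D"
  have "poly D 0 = 0" by (simp add: D_def)
  then have "P > 0" using \<open>D \<noteq> 0\<close> by (simp add: P_def order_root)
  obtain H where DH: "D = [:0, 1:] ^ P * H" and "\<not> [:0, 1:] dvd H"
    using order_decomp[OF \<open>D \<noteq> 0\<close>, of 0] by (auto simp: P_def)
  then have H0_nz: "poly H 0 \<noteq> 0" using poly_eq_0_iff_dvd[of H 0] by simp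

  \<comment> \<open>\<open>W\<close> is the derivative of \<open>u ^ P H u\<close> without the factor \<open>u ^ (P - 1)\<close>.\<close>
  define W where "W = smult (real P) H + [:0, 1:] * pderiv H"
  obtain P' where P': "P = Suc P'" using \<open>P > 0\<close> by (cases P) auto
  have deriv_W: "poly (pderiv g) u = u ^ (P - 1) * poly W u" for u
    unfolding pderiv_g DH P' W_def
    by (simp add: pderiv_mult pderiv_power_Suc poly_power pderiv_pCons algebra_simps del: power_Suc)
      (simp add: algebra_simps)
  have W_pos: "poly W u > 0" if "0 < u" "u < 1" for u
    using deriv_pos[OF that] that by (simp add: deriv_W zero_less_mult_iff)
  have "poly W 0 \<ge> 0"
  proof (rule continuous_ge_on_closure[where S = "{0<..<1}" and f = "poly W"])
    show "continuous_on (closure {0<..<1}) (poly W)" by (intro continuous_intros)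
  qed (use W_pos in \<open>auto simp: less_imp_le\<close>)
  then have W0: "poly W 0 > 0" and H0: "poly H 0 > 0"
    using H0_nz \<open>P > 0\<close> by (auto simp: W_def zero_le_mult_iff)
  \<comment> \<open>\<open>W\<close> may vanish at \<open>1\<close>; any bound strictly between \<open>1/2\<close> and \<open>1\<close> would do.\<close>
  have "\<exists>x\<in>{0..3/4}. \<forall>y\<in>{0..3/4}. poly W x \<le> poly W y"
    by (intro continuous_attains_inf continuous_intros) auto
  then obtain w where w: "0 \<le> w" "w \<le> 3/4" "\<And>u. 0 \<le> u \<Longrightarrow> u \<le> 3/4 \<Longrightarrow> poly W w \<le> poly W u"
    by auto
  define c0 where "c0 = poly W w"
  have "c0 > 0" unfolding c0_def using w W0 W_pos[of w] by (cases "w = 0") auto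
  note c0 = this w(3)[folded c0_def]

  have growth: "c0 * x ^ (P - 1) * (y - x) \<le> poly g y - poly g x" if xy: "0 \<le> x" "x \<le> y" "y \<le> 3/4" for x y
  proof (cases "x = y")
    case False
    then obtain z where z: "x < z" "z < y" "poly g y - poly g x = (y - x) * poly (pderiv g) z"
      using poly_MVT[of x y g] xy by auto
    have "x ^ (P - 1) * c0 \<le> z ^ (P - 1) * poly W z"
      using z xy c0 by (intro mult_mono power_mono) (auto simp: less_imp_le)
    then have "(y - x) * (x ^ (P - 1) * c0) \<le> (y - x) * poly (pderiv g) z"
      unfolding deriv_W using xy by (intro mult_left_mono) auto
    then show ?thesis using z by (simp add: mult_ac)
  qed simp

  obtain \<delta> where \<delta>: "\<delta> > 0" "\<And>u. \<bar>u\<bar> < \<delta> \<Longrightarrow> poly H u > poly H 0 / 2"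
  proof -
    have "isCont (poly H) 0" "0 < poly H 0 / 2" using H0 by auto
    then obtain d where "d > 0" "\<And>u. dist u 0 < d \<Longrightarrow> dist (poly H u) (poly H 0) < poly H 0 / 2"
      unfolding continuous_at_eps_delta by blast
    then have "d > 0" "\<And>u. \<bar>u\<bar> < d \<Longrightarrow> \<bar>poly H u - poly H 0\<bar> < poly H 0 / 2"
      by (simp_all add: dist_real_def)
    then show ?thesis by (intro that[of d]) (smt (verit) field_sum_of_halves)+
  qed

  obtain C where C: "C \<ge> 0" "\<And>n k. k \<le> n \<Longrightarrow>
      \<bar>bernstein_coeff g (real n) (real k) - poly g (real k / real n)\<bar>
        \<le> C * (real k / real n) ^ (P - 1) / real n"
    using bernstein_coeff_root_error[of 0 P H] by (auto simp: coeff_g poly_g DH)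
  obtain C1 where C1: "C1 \<ge> 0" "\<And>n k. P \<le> k \<Longrightarrow> k \<le> n \<Longrightarrow>
      \<bar>bernstein_coeff H (real n - real P) (real k - real P) - poly H (real k / real n)\<bar> \<le> C1 / real n"
    using bernstein_coeff_shift_error[of P H] by blast

  \<comment> \<open>Moving up from \<open>u\<close> needs only \<open>C \<le> K * c0\<close>. Moving down loses a factor \<open>2 ^ P\<close>: one \<open>2\<close> for
    using half of the step and \<open>2 ^ (P - 1)\<close> for the bound of the derivative at \<open>u / 2\<close>.\<close>
  define K where "K = C * 2 ^ P / c0 + 1"
  have "K > 0" using C(1) c0(1) by (simp add: K_def add_nonneg_pos)
  have Kc: "C * 2 ^ P \<le> K * c0" using c0(1) by (simp add: K_def field_simps)
  obtain n0 :: nat where n0: "real n0 > 4 * K + K / \<delta> + 2 * C1 / poly H 0"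
    using reals_Archimedean2 by blast

  show ?thesis
  proof (intro exI[of _ K] conjI exI[of _ n0] allI impI \<open>K > 0\<close>)
    fix n k :: nat
    assume n: "n0 \<le> n" and k: "2 * k \<le> n"
    define u where "u = real k / real n"
    define s where "s = K / real n"
    let ?\<gamma> = "bernstein_coeff g (real n) (real k)"
    have "K / \<delta> \<ge> 0" "2 * C1 / poly H 0 \<ge> 0" using \<open>K > 0\<close> \<delta> C1 H0 by auto
    then have big: "real n > 4 * K" "real n > K / \<delta>" "real n > 2 * C1 / poly H 0"
      using n0 n \<open>K > 0\<close> by linarith+
    then have "real n > 0" using \<open>K > 0\<close> by linarith
    then have s: "0 < s" "s \<le> 1/4" "s < \<delta>" and C1n: "C1 / real n < poly H 0 / 2"
      using big \<open>K > 0\<close> \<delta> H0 by (auto simp: s_def field_simps)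
    have u: "0 \<le> u" "u \<le> 1/2" using k \<open>real n > 0\<close> by (auto simp: u_def field_simps)
    have "k \<le> n" using k by simp
    note err = C(2)[OF \<open>k \<le> n\<close>, folded u_def]

    have upper: "?\<gamma> \<le> poly g (u + s)"
    proof -
      have "C * 1 \<le> C * 2 ^ P" using C(1) by (intro mult_left_mono) auto
      then have "C * (u ^ (P - 1) / real n) \<le> K * c0 * (u ^ (P - 1) / real n)"
        using Kc u \<open>real n > 0\<close> by (intro mult_right_mono) auto
      also have "\<dots> = c0 * u ^ (P - 1) * (u + s - u)" by (simp add: s_def)
      also have "\<dots> \<le> poly g (u + s) - poly g u" using u s by (intro growth) auto
      finally show ?thesis using err by (simp add: abs_le_iff)
    qed
    have lower: "poly g (max 0 (u - s)) \<le> ?\<gamma>"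
    proof (cases "u < s")
      case True
      have "0 \<le> bernstein_coeff H (real n - real P) (real k - real P)" if "P \<le> k"
      proof -
        have "poly H u > poly H 0 / 2" using u s True by (intro \<delta>(2)) simp
        moreover have "\<bar>bernstein_coeff H (real n - real P) (real k - real P) - poly H u\<bar> \<le> C1 / real n"
          unfolding u_def by (rule C1(2)[OF that \<open>k \<le> n\<close>])
        ultimately show ?thesis using C1n by linarith
      qed
      then have "0 \<le> bernstein_coeff D (real n) (real k)"
        unfolding DH by (intro bernstein_coeff_power_mult_nonneg \<open>k \<le> n\<close>)
      then show ?thesis using True by (simp add: poly_g coeff_g D_def)
    next
      case False
      \<comment> \<open>As \<open>u - s\<close> may be \<open>0\<close>, the derivative is bounded below on \<open>[u - s / 2, u]\<close> only.\<close>
      have "C * 2 ^ P * (u ^ (P - 1) / real n) \<le> K * c0 * (u ^ (P - 1) / real n)"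
        using Kc u \<open>real n > 0\<close> by (intro mult_right_mono) auto
      then have "C * u ^ (P - 1) / real n * 2 ^ P \<le> K * c0 * (u ^ (P - 1) / real n)"
        by (simp add: mult_ac)
      then have "C * u ^ (P - 1) / real n \<le> K * c0 * (u ^ (P - 1) / real n) / 2 ^ P"
        by (simp only: pos_le_divide_eq zero_less_power zero_less_numeral)
      also have "\<dots> = c0 * (u / 2) ^ (P - 1) * (s / 2)"
        by (simp add: s_def power_divide P' mult_ac)
      also have "\<dots> \<le> c0 * (u - s / 2) ^ (P - 1) * (s / 2)"
        using u s c0 False by (intro mult_right_mono mult_left_mono power_mono) auto
      also have "\<dots> = c0 * (u - s / 2) ^ (P - 1) * (u - (u - s / 2))" by simp
      also have "\<dots> \<le> poly g u - poly g (u - s / 2)"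
        using u s False by (intro growth) auto
      finally have "poly g (u - s / 2) \<le> ?\<gamma>" using err by (simp add: abs_le_iff)
      moreover have "0 \<le> c0 * (u - s) ^ (P - 1) * (u - s / 2 - (u - s))"
        using u s c0 False by simp
      then have "poly g (u - s) \<le> poly g (u - s / 2)"
        using growth[of "u - s" "u - s / 2"] u s False by simp
      ultimately show ?thesis using False by simp
    qed
    have "max 0 (u - s) \<le> u + s" using u s by simp
    then have "\<exists>t\<ge>max 0 (u - s). t \<le> u + s \<and> poly g t = ?\<gamma>"
      using lower upper by (intro IVT' continuous_intros)
    then obtain t where "max 0 (u - s) \<le> t" "t \<le> u + s" "poly g t = ?\<gamma>"
      by blast
    then show "\<exists>t\<in>{0..1}. poly g t = ?\<gamma> \<and> \<bar>t - real k / real n\<bar> \<le> K / real n"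
      using u s unfolding u_def[symmetric] s_def[symmetric] by (intro bexI[of _ t]) auto
  qed
qed

text \<open>Indices \<open>k > n / 2\<close> are treated by applying the previous lemma to \<open>- g (1 - u)\<close>.\<close>
lemma node_near:
  fixes g :: "real poly"
  assumes deriv_pos: "\<And>u. 0 < u \<Longrightarrow> u < 1 \<Longrightarrow> poly (pderiv g) u > 0"
  shows "\<exists>K>0. \<exists>n0. \<forall>n\<ge>n0. \<forall>k\<le>n.
    \<exists>t\<in>{0..1}. poly g t = bernstein_coeff g (real n) (real k) \<and> \<bar>t - real k / real n\<bar> \<le> K / real n"
proof -
  define g' where "g' = - (g \<circ>\<^sub>p [:1, -1:])"
  have "poly (pderiv g') u = poly (pderiv g) (1 - u)" for u
    by (simp add: g'_def pderiv_minus pderiv_pcompose pderiv_pCons poly_pcompose)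
  then have "\<And>u. 0 < u \<Longrightarrow> u < 1 \<Longrightarrow> poly (pderiv g') u > 0" using deriv_pos by simp
  from node_near_lower_half[OF this] obtain K2 n2 where 2: "K2 > 0" "\<And>n k. n2 \<le> n \<Longrightarrow> 2 * k \<le> n \<Longrightarrow>
    \<exists>t\<in>{0..1}. poly g' t = bernstein_coeff g' (real n) (real k) \<and> \<bar>t - real k / real n\<bar> \<le> K2 / real n"
    by blast
  from node_near_lower_half[OF deriv_pos] obtain K1 n1 where 1: "K1 > 0" "\<And>n k. n1 \<le> n \<Longrightarrow> 2 * k \<le> n \<Longrightarrow>
    \<exists>t\<in>{0..1}. poly g t = bernstein_coeff g (real n) (real k) \<and> \<bar>t - real k / real n\<bar> \<le> K1 / real n"
    by blast
  show ?thesis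
  proof (intro exI[of _ "K1 + K2"] conjI exI[of _ "max (max n1 n2) (max 1 (degree g))"] allI impI)
    fix n k :: nat
    assume n: "max (max n1 n2) (max 1 (degree g)) \<le> n" and "k \<le> n"
    have K: "K1 / real n \<le> (K1 + K2) / real n" "K2 / real n \<le> (K1 + K2) / real n"
      using 1(1) 2(1) by (auto intro: divide_right_mono)
    show "\<exists>t\<in>{0..1}. poly g t = bernstein_coeff g (real n) (real k)
        \<and> \<bar>t - real k / real n\<bar> \<le> (K1 + K2) / real n"
    proof (cases "2 * k \<le> n")
      case True
      then show ?thesis using 1(2)[of n k] n K(1) by force
    next
      case False
      then have "2 * (n - k) \<le> n" by simp
      then obtain t where t: "t \<in> {0..1}" "poly g' t = bernstein_coeff g' (real n) (real (n - k))"
        "\<bar>t - real (n - k) / real n\<bar> \<le> K2 / real n"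
        using 2(2)[of n "n - k"] n by force
      have "poly g (1 - t) = bernstein_coeff g (real n) (real k)"
        using t(2) bernstein_coeff_reflect[of g n k] n \<open>k \<le> n\<close>
        by (simp add: g'_def bernstein_coeff_minus poly_pcompose del: of_nat_diff)
      moreover have "1 - t - real k / real n = - (t - real (n - k) / real n)"
        using n \<open>k \<le> n\<close> by (simp add: of_nat_diff field_simps)
      then have "\<bar>1 - t - real k / real n\<bar> \<le> (K1 + K2) / real n"
        using t(3) K(2) by (simp only: abs_minus_cancel)
      ultimately show ?thesis using t(1) by (intro bexI[of _ "1 - t"]) auto
    qed
  qed (use 1(1) 2(1) in simp)
qed

section \<open>Transfer to the operators on an interval\<close>

lemma abs_diff_le_modulus_of_continuity:
  assumes "continuous_on {a..b} f" "x \<in> {a..b}" "y \<in> {a..b}" "\<bar>x - y\<bar> \<le> \<delta>"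
  shows "\<bar>f x - f y\<bar> \<le> modulus_of_continuity a b f \<delta>"
  unfolding modulus_of_continuity_def
proof (rule cSup_upper)
  have "bounded (f ` {a..b})"
    using assms(1) by (intro compact_imp_bounded compact_continuous_image) auto
  then obtain M where "\<forall>y\<in>f ` {a..b}. norm y \<le> M"
    unfolding bounded_iff by blast
  then have M: "\<bar>f x\<bar> \<le> M" if "x \<in> {a..b}" for x
    using that by auto
  show "bdd_above {\<bar>f x - f y\<bar> |x y. x \<in> {a..b} \<and> y \<in> {a..b} \<and> \<bar>x - y\<bar> \<le> \<delta>}"
  proof (intro bdd_aboveI[of _ "2 * M"])
    fix z assume "z \<in> {\<bar>f x - f y\<bar> |x y. x \<in> {a..b} \<and> y \<in> {a..b} \<and> \<bar>x - y\<bar> \<le> \<delta>}"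
    then obtain x y where "z = \<bar>f x - f y\<bar>" "x \<in> {a..b}" "y \<in> {a..b}" by auto
    then show "z \<le> 2 * M" using M[of x] M[of y] by linarith
  qed
qed (use assms in blast)

lemma affine_unit_mem:
  fixes a b u :: real
  assumes "a < b" "u \<in> {0..1}"
  shows "a + u * (b - a) \<in> {a..b}"
proof -
  have "0 \<le> u * (b - a)" "u * (b - a) \<le> 1 * (b - a)"
    using assms by (intro mult_nonneg_nonneg mult_right_mono; simp)+
  then show ?thesis unfolding atLeastAtMost_iff by (simp only: mult_1) linarith
qed

lemma bernstein_basis_affine:
  assumes "a < b" "k \<le> n"
  shows "bernstein_basis a b n k (a + u * (b - a)) = Bernstein n k u"
  using assms by (simp add: bernstein_basis_eq_Bernstein)

lemma bernstein_basis_coeffs_eqI: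
  assumes "a < b"
    and eq: "\<And>x. x \<in> {a..b} \<Longrightarrow>
      (\<Sum>k\<le>n. c k * bernstein_basis a b n k x) = (\<Sum>k\<le>n. d k * bernstein_basis a b n k x)"
    and "k \<le> n"
  shows "c k = d k"
proof (rule Bernstein_coeffs_eqI[OF _ \<open>k \<le> n\<close>])
  fix u :: real assume "0 < u" "u < 1"
  then have "a + u * (b - a) \<in> {a..b}" using \<open>a < b\<close> by (intro affine_unit_mem[OF \<open>a < b\<close>]) auto
  from eq[OF this] show "(\<Sum>k\<le>n. c k * Bernstein n k u) = (\<Sum>k\<le>n. d k * Bernstein n k u)"
    using \<open>a < b\<close> by (simp add: bernstein_basis_affine)
qed

lemma sum_bernstein_basis:
  assumes "a < b"
  shows "(\<Sum>k\<le>n. bernstein_basis a b n k x) = 1"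
  using assms by (simp add: bernstein_basis_eq_Bernstein)

lemma bernstein_basis_nonneg:
  assumes "a < b" "x \<in> {a..b}"
  shows "0 \<le> bernstein_basis a b n k x"
  using assms by (simp add: bernstein_basis_def)

text \<open>
  Existence and uniqueness of the operator, once nodes with the right values are known: fixing the
  constant function determines the weights, and fixing the injective \<open>f1\<close> the nodes.
\<close>
lemma generalized_bernstein_fixing_iff:
  assumes "a < b" and inj: "inj_on f1 {a..b}"
    and f1: "\<And>x. x \<in> {a..b} \<Longrightarrow> f1 x = (\<Sum>k\<le>n. f1 (\<tau> k) * bernstein_basis a b n k x)"
    and \<tau>: "\<And>k. k \<le> n \<Longrightarrow> \<tau> k \<in> {a..b}"
  shows "generalized_bernstein_fixing a b f1 n T \<longleftrightarrow>
    T = (\<lambda>f x. \<Sum>k\<le>n. f (\<tau> k) * bernstein_basis a b n k x)"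
proof
  assume "generalized_bernstein_fixing a b f1 n T"
  then obtain t \<alpha> where t: "\<And>k. k \<le> n \<Longrightarrow> t k \<in> {a..b}"
    and T: "T = (\<lambda>f x. \<Sum>k\<le>n. f (t k) * \<alpha> k * bernstein_basis a b n k x)"
    and fix1: "\<And>x. x \<in> {a..b} \<Longrightarrow> T (\<lambda>_. 1) x = 1"
    and fixf: "\<And>x. x \<in> {a..b} \<Longrightarrow> T f1 x = f1 x"
    unfolding generalized_bernstein_fixing_def generalized_bernstein_def fixes_on_def by blast
  have \<alpha>: "\<alpha> k = 1" if "k \<le> n" for k
    using fix1 \<open>a < b\<close>
    by (intro bernstein_basis_coeffs_eqI[where c = \<alpha> and d = "\<lambda>_. 1", OF \<open>a < b\<close> _ that])
      (simp add: T sum_bernstein_basis)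
  have "f1 (t k) = f1 (\<tau> k)" if "k \<le> n" for k
  proof (rule bernstein_basis_coeffs_eqI[OF \<open>a < b\<close> _ that, where c = "\<lambda>k. f1 (t k)"])
    fix x assume "x \<in> {a..b}"
    then show "(\<Sum>k\<le>n. f1 (t k) * bernstein_basis a b n k x) = (\<Sum>k\<le>n. f1 (\<tau> k) * bernstein_basis a b n k x)"
      using fixf[of x] f1[of x] by (simp add: T \<alpha>)
  qed
  then have "t k = \<tau> k" if "k \<le> n" for k
    using inj_onD[OF inj _ t[OF that] \<tau>[OF that]] that by blast
  then show "T = (\<lambda>f x. \<Sum>k\<le>n. f (\<tau> k) * bernstein_basis a b n k x)"
    by (simp add: T \<alpha>)
next
  assume T: "T = (\<lambda>f x. \<Sum>k\<le>n. f (\<tau> k) * bernstein_basis a b n k x)"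
  then have "generalized_bernstein a b n T"
    unfolding generalized_bernstein_def using \<tau> by (intro exI[of _ \<tau>] exI[of _ "\<lambda>_. 1"]) simp
  then show "generalized_bernstein_fixing a b f1 n T"
    unfolding generalized_bernstein_fixing_def fixes_on_def
    using T f1 \<open>a < b\<close> by (auto simp: sum_bernstein_basis)
qed

theorem theorem6p5:
  fixes a b :: real and f1 :: "real poly" and m :: nat
  assumes "a < b"
    and "degree f1 = m" and "m \<ge> 1"
    and "\<forall>x\<in>{a<..<b}. poly (pderiv f1) x > 0"
  shows "\<exists>K>0. \<exists>n0.
    (\<forall>n\<ge>n0. \<exists>!T. generalized_bernstein_fixing a b (poly f1) n T) \<and>
    (\<forall>f. continuous_on {a..b} f \<longrightarrow>
      (\<forall>x\<in>{a..b}. \<forall>n\<ge>n0.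
        \<bar>bernstein_fixing a b (poly f1) n f x - classical_bernstein a b n f x\<bar>
          \<le> modulus_of_continuity a b f (K * inverse (real n))))"
proof -
  define g where "g = f1 \<circ>\<^sub>p [:a, b - a:]"
  have poly_g: "poly g u = poly f1 (a + u * (b - a))" for u
    by (simp add: g_def poly_pcompose)
  have "poly (pderiv g) u > 0" if "0 < u" "u < 1" for u
  proof -
    have "0 < u * (b - a)" "u * (b - a) < 1 * (b - a)"
      using that \<open>a < b\<close> by (intro mult_pos_pos mult_strict_right_mono; simp)+
    then have "a + u * (b - a) \<in> {a<..<b}"
      unfolding greaterThanLessThan_iff by (simp only: mult_1) linarith
    then have "poly (pderiv f1) (a + u * (b - a)) > 0" using assms(4) by blast
    then show ?thesis
      using \<open>a < b\<close> by (simp add: g_def pderiv_pcompose poly_pcompose pderiv_pCons)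
  qed
  from node_near[OF this] obtain K n0 where K: "K > 0"
    and "\<forall>n\<ge>n0. \<forall>k\<le>n. \<exists>t\<in>{0..1}. poly g t = bernstein_coeff g (real n) (real k)
          \<and> \<bar>t - real k / real n\<bar> \<le> K / real n"
    by blast
  then have "\<exists>t. n0 \<le> n \<longrightarrow> k \<le> n \<longrightarrow> t \<in> {0..1} \<and> poly g t = bernstein_coeff g (real n) (real k)
      \<and> \<bar>t - real k / real n\<bar> \<le> K / real n" for n k
    by blast
  then obtain t where "\<And>n k. n0 \<le> n \<longrightarrow> k \<le> n \<longrightarrow> t n k \<in> {0..1}
      \<and> poly g (t n k) = bernstein_coeff g (real n) (real k) \<and> \<bar>t n k - real k / real n\<bar> \<le> K / real n"
    by metis
  then have t: "t n k \<in> {0..1}" "poly g (t n k) = bernstein_coeff g (real n) (real k)"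
      "\<bar>t n k - real k / real n\<bar> \<le> K / real n" if "n0 \<le> n" "k \<le> n" for n k
    using that by blast+
  define \<tau> where "\<tau> n k = a + t n k * (b - a)" for n k

  have "strict_mono_on {a..b} (poly f1)"
  proof (rule strict_mono_onI)
    fix x y assume xy: "x \<in> {a..b}" "y \<in> {a..b}" "x < y"
    obtain z where z: "x < z" "z < y" "poly f1 y - poly f1 x = (y - x) * poly (pderiv f1) z"
      using poly_MVT[OF \<open>x < y\<close>, of f1] by blast
    have "poly (pderiv f1) z > 0" using assms(4) xy z by simp
    then have "0 < (y - x) * poly (pderiv f1) z" using xy by simp
    then show "poly f1 x < poly f1 y" using z by simp
  qed
  then have inj: "inj_on (poly f1) {a..b}" by (rule strict_mono_on_imp_inj_on)

  have fixing_iff: "generalized_bernstein_fixing a b (poly f1) n T \<longleftrightarrow>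
      T = (\<lambda>f x. \<Sum>k\<le>n. f (\<tau> n k) * bernstein_basis a b n k x)"
    if n: "max n0 m \<le> n" for n T
  proof (rule generalized_bernstein_fixing_iff[OF \<open>a < b\<close> inj])
    fix x assume "x \<in> {a..b}"
    have "degree g \<le> n" using assms(1,2) n by (simp add: g_def degree_pcompose)
    have "poly f1 x = poly g ((x - a) / (b - a))" using \<open>a < b\<close> by (simp add: poly_g)
    also have "\<dots> = (\<Sum>k\<le>n. bernstein_coeff g (real n) (real k) * Bernstein n k ((x - a) / (b - a)))"
      by (rule poly_eq_bernstein_sum[OF \<open>degree g \<le> n\<close>])
    also have "\<dots> = (\<Sum>k\<le>n. poly f1 (\<tau> n k) * bernstein_basis a b n k x)"
      using n t(2) \<open>a < b\<close>
      by (intro sum.cong) (auto simp: \<tau>_def bernstein_basis_eq_Bernstein simp flip: poly_g)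
    finally show "poly f1 x = (\<Sum>k\<le>n. poly f1 (\<tau> n k) * bernstein_basis a b n k x)" .
  next
    fix k assume "k \<le> n"
    then show "\<tau> n k \<in> {a..b}" using t(1) n affine_unit_mem[OF \<open>a < b\<close>] by (simp add: \<tau>_def del: atLeastAtMost_iff)
  qed

  show ?thesis
  proof (intro exI[of _ "(b - a) * K"] exI[of _ "max n0 m"] conjI allI ballI impI)
    show "(b - a) * K > 0" using K \<open>a < b\<close> by simp
  next
    fix n assume "max n0 m \<le> n"
    then show "\<exists>!T. generalized_bernstein_fixing a b (poly f1) n T" by (simp add: fixing_iff)
  next
    fix f :: "real \<Rightarrow> real" and x n
    assume f: "continuous_on {a..b} f" and x: "x \<in> {a..b}" and n: "max n0 m \<le> n"
    let ?\<omega> = "modulus_of_continuity a b f ((b - a) * K * inverse (real n))"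
    let ?x = "\<lambda>k. a + real k / real n * (b - a)"
    have fixing: "bernstein_fixing a b (poly f1) n = (\<lambda>f x. \<Sum>k\<le>n. f (\<tau> n k) * bernstein_basis a b n k x)"
      unfolding bernstein_fixing_def fixing_iff[OF n] by (rule the_eq_trivial)
    have node: "\<bar>f (\<tau> n k) - f (?x k)\<bar> \<le> ?\<omega>" if "k \<le> n" for k
    proof (rule abs_diff_le_modulus_of_continuity[OF f])
      show "\<tau> n k \<in> {a..b}" using t(1) n affine_unit_mem[OF \<open>a < b\<close>] that by (simp add: \<tau>_def del: atLeastAtMost_iff)
      show "?x k \<in> {a..b}" using that by (intro affine_unit_mem[OF \<open>a < b\<close>]) (simp add: divide_le_eq)
      have "\<tau> n k - ?x k = (b - a) * (t n k - real k / real n)" by (simp add: \<tau>_def algebra_simps)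
      then have "\<bar>\<tau> n k - ?x k\<bar> = (b - a) * \<bar>t n k - real k / real n\<bar>"
        using \<open>a < b\<close> by (simp add: abs_mult)
      also have "\<dots> \<le> (b - a) * (K / real n)" using \<open>a < b\<close> t(3) n that by (intro mult_left_mono) auto
      finally show "\<bar>\<tau> n k - ?x k\<bar> \<le> (b - a) * K * inverse (real n)" by (simp add: divide_inverse mult.assoc)
    qed
    have "\<bar>bernstein_fixing a b (poly f1) n f x - classical_bernstein a b n f x\<bar>
        = \<bar>\<Sum>k\<le>n. (f (\<tau> n k) - f (?x k)) * bernstein_basis a b n k x\<bar>"
      by (simp add: fixing classical_bernstein_def sum_subtractf left_diff_distrib)
    also have "\<dots> \<le> (\<Sum>k\<le>n. ?\<omega> * bernstein_basis a b n k x)"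
      using node bernstein_basis_nonneg[OF \<open>a < b\<close> x]
      by (intro order_trans[OF sum_abs] sum_mono) (auto simp: abs_mult intro!: mult_right_mono)
    also have "\<dots> = ?\<omega>" using \<open>a < b\<close> by (simp add: sum_bernstein_basis flip: sum_distrib_left)
    finally show "\<bar>bernstein_fixing a b (poly f1) n f x - classical_bernstein a b n f x\<bar> \<le> ?\<omega>" .
  qed
qed

end
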